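(* Define $f:\mathbb{R}^n_{>0}\to\mathbb{R}$ by $f(m)=\operatorname{Trace}\big(B(m)^{\mathsf T}P(m)B(m)\big)$, where $P(m)=\mathrm{Lyap}\big(A(m),C^{\mathsf T}C\big)$. Then $f$ is differentiable on $\mathbb{R}^n_{>0}$, and its gradient at $m$ is the vector $g=(g_1,\dots,g_n)$ produced by the following algorithm. Set $$A^{(0)}=\begin{bmatrix}0&I\\ -M^{-1}L&-M^{-1}D\end{bmatrix},\quad B^{(0)}=\begin{bmatrix}0\\ M^{-1}V^{1/2}\end{bmatrix},\quad P^{(0)}=\mathrm{Lyap}\big(A^{(0)},C^{\mathsf T}C\big),$$ and, for each $i=1,\dots,n$, with $\Phi=e_ie_i^{\mathsf T}$ ($e_i$ the $i$-th canonical basis vector of $\mathbb{R}^n$), $$A^{(1)}=\begin{bmatrix}0&0\\ \Phi M^{-2}L&\Phi M^{-2}D\end{bmatrix},\quad B^{(1)}=\begin{bmatrix}0\\ -\Phi M^{-2}V^{1/2}\end{bmatrix},$$ $$P^{(1)}=\mathrm{Lyap}\big(A^{(0)},\,P^{(0)}A^{(1)}+{A^{(1)}}^{\mathsf T}P^{(0)}\big),$$ $$g_i=\operatorname{Trace}\big(2\,{B^{(1)}}^{\mathsf T}P^{(0)}B^{(0)}+{B^{(0)}}^{\mathsf T}P^{(1)}B^{(0)}\big).$$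
   Context: Setting. Let $n\ge 1$. The power network has nodes $\{1,\dots,n\}$ and symmetric susceptances $b_{ij}=b_{ji}\ge 0$ ($i\ne j$); $L\in\mathbb{R}^{n\times n}$ is the corresponding weighted graph Laplacian, with off-diagonal entries $-b_{ij}$ and diagonal entries $\sum_{j\ne i}b_{ij}$. The network graph (edges $\{i,j\}$ with $b_{ij}>0$) is connected. For $m\in\mathbb{R}^n_{>0}$ (vectors with all entries positive; the inertia coefficients) let $M=\operatorname{diag}\{m_i\}$; let $D=\operatorname{diag}\{d_i\}$ with damping coefficients $d_i>0$, and $V=\operatorname{diag}\{v_i\}$ with disturbance strengths $v_i\ge 0$. Penalties (fixed, not depending on $m$): $S=\operatorname{diag}\{s_i\}$ with $s_i>0$, and $N$ is the Laplacian matrix of a connected weighted graph on $\{1,\dots,n\}$ with weights $a_{ij}=a_{ji}\ge 0$. Put $$A(m)=\begin{bmatrix}0&I\\ -M^{-1}L&-M^{-1}D\end{bmatrix},\quad B(m)=\begin{bmatrix}0\\ M^{-1}V^{1/2}\end{bmatrix},\quad C=\begin{bmatrix}N^{1/2}&0\\ 0&S^{1/2}\end{bmatrix}.$$ Let $z_0\in\mathbb{R}^{2n}$ be the vector whose first $n$ entries are $1$ and whose last $n$ entries are $0$. $\mathrm{Lyap}(A,Q)$ denotes the matrix $P\in\mathbb{R}^{2n\times 2n}$ that solves $PA+A^{\mathsf T}P+Q=0$ together with $Pz_0=0$. (The value $f(m)$ is the squared $\mathscr{H}_2$ norm of the linear system with matrices $A(m),B(m),C$.) *)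

theory Defs
  imports "HOL-Analysis.Analysis"
begin

text \<open>
  Nodes are the elements of an arbitrary finite type \<open>'n\<close>. The state space is indexed by
  \<open>'n + 'n\<close>: \<open>Inl\<close> selects the first \<open>n\<close> coordinates and \<open>Inr\<close> the last \<open>n\<close>.
  Recall that \<open>real^'c^'r\<close> is the type of matrices with rows \<open>'r\<close> and columns \<open>'c\<close>.
\<close>

definition diag :: "real^'n \<Rightarrow> real^'n^'n" where
  "diag x = (\<chi> i j. if i = j then x $ i else 0)"

definition block22 :: "real^'c^'a \<Rightarrow> real^'d^'a \<Rightarrow> real^'c^'b \<Rightarrow> real^'d^'b \<Rightarrow> real^('c + 'd)^('a + 'b)"
  where
  "block22 X Y Z W = (\<chi> i j. case i of
      Inl r \<Rightarrow> (case j of Inl c \<Rightarrow> X $ r $ c | Inr c \<Rightarrow> Y $ r $ c)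
    | Inr r \<Rightarrow> (case j of Inl c \<Rightarrow> Z $ r $ c | Inr c \<Rightarrow> W $ r $ c))"

definition block21 :: "real^'c^'a \<Rightarrow> real^'c^'b \<Rightarrow> real^'c^('a + 'b)" where
  "block21 X Y = (\<chi> i j. case i of Inl r \<Rightarrow> X $ r $ j | Inr r \<Rightarrow> Y $ r $ j)"

definition psd :: "real^'n^'n \<Rightarrow> bool" where
  "psd X \<longleftrightarrow> transpose X = X \<and> (\<forall>x. 0 \<le> x \<bullet> (X *v x))"

text \<open>The principal square root; meaningful for positive semidefinite arguments.\<close>

definition psd_sqrt :: "real^'n^'n \<Rightarrow> real^'n^'n" where
  "psd_sqrt X = (THE R. psd R \<and> R ** R = X)"

text \<open>
  A weighted undirected graph is given by its weights \<open>w i j\<close>; diagonal values \<open>w i i\<close> are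
  never used.
\<close>

definition weighted_graph :: "('n \<Rightarrow> 'n \<Rightarrow> real) \<Rightarrow> bool" where
  "weighted_graph w \<longleftrightarrow> (\<forall>i j. i \<noteq> j \<longrightarrow> w i j = w j i \<and> 0 \<le> w i j)"

definition connected_graph :: "('n \<Rightarrow> 'n \<Rightarrow> real) \<Rightarrow> bool" where
  "connected_graph w \<longleftrightarrow> (\<forall>i j. (i, j) \<in> {(k, l). k \<noteq> l \<and> 0 < w k l}\<^sup>*)"

definition laplacian :: "('n::finite \<Rightarrow> 'n \<Rightarrow> real) \<Rightarrow> real^'n^'n" where
  "laplacian w = (\<chi> i j. if i = j then (\<Sum>k\<in>UNIV - {i}. w i k) else - w i j)"

definition z0 :: "real^('n::finite + 'n)" where
  "z0 = (\<chi> i. case i of Inl _ \<Rightarrow> 1 | Inr _ \<Rightarrow> 0)"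

definition lyap :: "real^('n::finite + 'n)^('n + 'n) \<Rightarrow> real^('n + 'n)^('n + 'n) \<Rightarrow> real^('n + 'n)^('n + 'n)"
  where
  "lyap A Q = (THE P. P ** A + transpose A ** P + Q = 0 \<and> P *v z0 = 0)"

text \<open>
  In the following, \<open>L\<close> and \<open>N\<close> are Laplacians, and \<open>m\<close>, \<open>d\<close>, \<open>v\<close>, \<open>s\<close> are the diagonals of
  \<open>M\<close>, \<open>D\<close>, \<open>V\<close>, \<open>S\<close>.
\<close>

definition sysA :: "real^'n^'n \<Rightarrow> real^'n \<Rightarrow> real^'n \<Rightarrow> real^('n::finite + 'n)^('n + 'n)" where
  "sysA L d m = block22 0 (mat 1)
     (- (matrix_inv (diag m) ** L)) (- (matrix_inv (diag m) ** diag d))"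

definition sysB :: "real^'n \<Rightarrow> real^'n \<Rightarrow> real^'n^('n::finite + 'n)" where
  "sysB v m = block21 0 (matrix_inv (diag m) ** psd_sqrt (diag v))"

definition sysC :: "real^'n^'n \<Rightarrow> real^'n \<Rightarrow> real^('n::finite + 'n)^('n + 'n)" where
  "sysC N s = block22 (psd_sqrt N) 0 0 (psd_sqrt (diag s))"

definition obsv_gram ::
  "real^'n^'n \<Rightarrow> real^'n^'n \<Rightarrow> real^'n \<Rightarrow> real^'n \<Rightarrow> real^'n \<Rightarrow> real^('n::finite + 'n)^('n + 'n)" where
  "obsv_gram L N d s m = lyap (sysA L d m) (transpose (sysC N s) ** sysC N s)"

definition h2sq ::
  "real^'n^'n \<Rightarrow> real^'n^'n \<Rightarrow> real^'n \<Rightarrow> real^'n \<Rightarrow> real^'n \<Rightarrow> real^'n::finite \<Rightarrow> real" where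
  "h2sq L N d v s m = trace (transpose (sysB v m) ** obsv_gram L N d s m ** sysB v m)"

definition grad_alg ::
  "real^'n^'n \<Rightarrow> real^'n^'n \<Rightarrow> real^'n \<Rightarrow> real^'n \<Rightarrow> real^'n \<Rightarrow> real^'n::finite \<Rightarrow> real^'n" where
  "grad_alg L N d v s m =
    (let Minv = matrix_inv (diag m);
         A0 = sysA L d m;
         B0 = sysB v m;
         P0 = obsv_gram L N d s m
     in \<chi> i.
       (let \<Phi> = (columnvector (axis i 1) :: real^1^'n) ** (rowvector (axis i 1) :: real^'n^1);
            A1 = block22 0 0 (\<Phi> ** (Minv ** Minv) ** L) (\<Phi> ** (Minv ** Minv) ** diag d);
            B1 = block21 0 (- (\<Phi> ** (Minv ** Minv) ** psd_sqrt (diag v)));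
            P1 = lyap A0 (P0 ** A1 + transpose A1 ** P0)
        in trace (2 *\<^sub>R (transpose B1 ** P0 ** B0) + transpose B0 ** P1 ** B0)))"

end

theory Submission
  imports Defs
begin

text \<open>
  The operator \<open>T(P) = P A + A\<^sup>T P\<close> preserves the space \<open>W\<close> of matrices annihilating \<open>z0\<close>,
  because \<open>A z0 = 0\<close>. It is injective on \<open>W\<close>: the energy \<open>x \<bullet> L x + y \<bullet> M y\<close>, completed by the
  square of the conserved functional \<open>(d, m)\<close>, is a quadratic Lyapunov function with
  dissipation \<open>2 D\<close> on the velocities, and a LaSalle-type argument forces a solution of
  \<open>T(P) = 0\<close> to have the form \<open>E z0 c\<^sup>T\<close> with \<open>c\<^sup>T A = 0\<close> and \<open>c \<bullet> z0 = 0\<close>, hence \<open>c = 0\<close>.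
  By finite dimension \<open>T\<close> is bijective on \<open>W\<close>, so Lyapunov solutions exist, are unique, and
  depend differentiably on \<open>m\<close>; differentiating the equation gives the equation that defines the
  first-order term of the algorithm. The two product-rule terms with the derivative of \<open>B\<close> coincide since \<open>P\<close> is symmetric. The matrix \<open>C\<^sup>T C\<close>
  annihilates \<open>z0\<close> because the principal square root of \<open>N\<close> has the same kernel as \<open>N\<close>; its
  existence and uniqueness come from an orthonormal eigenbasis.
\<close>

section \<open>Principal square roots\<close>

text \<open>Along the line \<open>x + t y\<close> the form is a nonnegative polynomial in
  \<open>t\<close> without constant term, so its linear coefficient vanishes.\<close>

lemma nonneg_quadratic_form_null:
  fixes g :: "'a::real_inner \<Rightarrow> 'a"
  assumes "linear g" and sym: "\<And>x y. g x \<bullet> y = x \<bullet> g y"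
    and "subspace W" and nonneg: "\<And>y. y \<in> W \<Longrightarrow> 0 \<le> y \<bullet> g y"
    and x: "x \<in> W" "x \<bullet> g x = 0" and y: "y \<in> W"
  shows "y \<bullet> g x = 0"
proof -
  interpret linear g by fact
  define a b where "a = y \<bullet> g x" and "b = y \<bullet> g y"
  \<comment> \<open>Near the minimiser \<open>- a / b\<close>; the \<open>+ 1\<close> keeps the
    denominator positive when \<open>b = 0\<close>, and the form still becomes
    \<open>- t^2 (b + 2)\<close>.\<close>
  define t where "t = - a / (b + 1)"
  have b: "b \<ge> 0" using nonneg y by (simp add: b_def)
  have "x + t *\<^sub>R y \<in> W" using assms by (simp add: subspace_add subspace_mul)
  then have "0 \<le> (x + t *\<^sub>R y) \<bullet> g (x + t *\<^sub>R y)" by (rule nonneg)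
  also have "\<dots> = 2 * t * a + t\<^sup>2 * b"
    using x sym[of x y]
    by (simp add: add scale inner_add_left inner_add_right a_def b_def power2_eq_square inner_commute)
  also have "\<dots> = - (t\<^sup>2 * (b + 2))"
  proof -
    have a: "a = - t * (b + 1)" using b by (simp add: t_def)
    show ?thesis by (subst a) (simp add: algebra_simps power2_eq_square)
  qed
  finally have "t\<^sup>2 * (b + 2) \<le> 0" by simp
  then have "t = 0" using b by (simp add: mult_le_0_iff)
  then show ?thesis using b by (simp add: t_def a_def)
qed

text \<open>Spectral theorem by induction on the dimension: a maximiser of
  \<open>x \<bullet> f x\<close> on the unit sphere of \<open>W\<close> is an eigenvector, and by
  self-adjointness its orthogonal complement in \<open>W\<close> is again invariant.\<close>

lemma self_adjoint_eigenbasis_on: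
  fixes f :: "'a::euclidean_space \<Rightarrow> 'a"
  assumes f: "linear f" and sym: "\<And>x y. f x \<bullet> y = x \<bullet> f y"
    and "subspace W" and "f ` W \<subseteq> W"
  shows "\<exists>B. B \<subseteq> W \<and> finite B \<and> pairwise orthogonal B \<and>
    (\<forall>b\<in>B. norm b = 1 \<and> (\<exists>l. f b = l *\<^sub>R b)) \<and> W \<subseteq> span B"
  using assms(3,4)
proof (induction "dim W" arbitrary: W rule: less_induct)
  case less
  interpret linear f by fact
  show ?case
  proof (cases "W \<subseteq> {0}")
    case True
    then show ?thesis by (intro exI[of _ "{}"]) auto
  next
    case False
    then obtain w where w: "w \<in> W" "w \<noteq> 0" by auto
    let ?K = "sphere 0 1 \<inter> W"
    have "compact ?K"
      using less.prems by (simp add: closed_subspace compact_Int_closed)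
    moreover have "(1 / norm w) *\<^sub>R w \<in> ?K"
      using w less.prems by (simp add: subspace_mul)
    then have "?K \<noteq> {}" by blast
    moreover have "continuous_on ?K (\<lambda>x. x \<bullet> f x)"
      by (intro continuous_intros linear_continuous_on linear_conv_bounded_linear[THEN iffD1] f)
    ultimately obtain x where x: "x \<in> ?K" and max: "\<And>y. y \<in> ?K \<Longrightarrow> y \<bullet> f y \<le> x \<bullet> f x"
      using continuous_attains_sup by metis
    have xW: "x \<in> W" and nx: "norm x = 1" and xx: "x \<bullet> x = 1"
      using x by (auto simp: dot_square_norm)
    define l where "l = x \<bullet> f x"
    \<comment> \<open>The form of \<open>g\<close> is nonnegative on \<open>W\<close> and vanishes
      at the maximiser \<open>x\<close>, so \<open>g x\<close> is orthogonal to all of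
      \<open>W\<close>. Invariance puts \<open>g x\<close> itself in \<open>W\<close>, hence
      \<open>g x = 0\<close>.\<close>
    define g where "g y = l *\<^sub>R y - f y" for y
    have g: "linear g" unfolding g_def
      by (intro linear_compose_sub f linear_scale_self)
    have gsym: "g u \<bullet> v = u \<bullet> g v" for u v
      by (simp add: g_def inner_diff_left inner_diff_right sym)
    have gnn: "0 \<le> y \<bullet> g y" if "y \<in> W" for y
    proof (cases "y = 0")
      case False
      have "(1 / norm y) *\<^sub>R y \<in> ?K"
        using False that less.prems by (simp add: subspace_mul)
      from max[OF this] have "(y \<bullet> f y) / (norm y)\<^sup>2 \<le> l"
        by (simp add: scale l_def power2_eq_square)
      then have "y \<bullet> f y \<le> l * (norm y)\<^sup>2" using False by (simp add: field_simps)
      then show ?thesis by (simp add: g_def inner_diff_right dot_square_norm)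
    qed simp
    have gx: "x \<bullet> g x = 0" using xx by (simp add: g_def inner_diff_right l_def)
    have "g x \<in> W" unfolding g_def
      using less.prems xW by (auto intro!: subspace_diff subspace_mul)
    from nonneg_quadratic_form_null[OF g gsym less.prems(1) gnn xW gx this]
    have fx: "f x = l *\<^sub>R x" by (simp add: g_def)
    define W' where "W' = {y \<in> W. x \<bullet> y = 0}"
    have W': "subspace W'"
      using less.prems(1) unfolding W'_def subspace_def by (auto simp: inner_add_right)
    have inv: "f ` W' \<subseteq> W'"
    proof -
      have "x \<bullet> f y = 0" if "x \<bullet> y = 0" for y
        using that by (simp add: sym[symmetric] fx)
      then show ?thesis using less.prems(2) by (auto simp: W'_def)
    qed
    have "dim W' < dim W"
    proof (rule dim_psubset)
      have "x \<notin> W'" using xx by (simp add: W'_def)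
      then show "span W' \<subset> span W"
        using W' less.prems(1) xW by (simp add: span_eq_iff[THEN iffD2]) (metis (lifting) W'_def mem_Collect_eq psubsetI subsetI)
    qed
    from less.hyps[OF this W' inv] obtain B where B: "B \<subseteq> W'" "finite B" "pairwise orthogonal B"
      "\<forall>b\<in>B. norm b = 1 \<and> (\<exists>l. f b = l *\<^sub>R b)" "W' \<subseteq> span B" by blast
    show ?thesis
    proof (intro exI[of _ "insert x B"] conjI)
      show "insert x B \<subseteq> W" using B(1) xW by (auto simp: W'_def)
      show "pairwise orthogonal (insert x B)"
        using B(1,3) by (auto simp: pairwise_insert orthogonal_def W'_def inner_commute)
      show "\<forall>b\<in>insert x B. norm b = 1 \<and> (\<exists>l. f b = l *\<^sub>R b)" using B(4) nx fx by auto
      show "W \<subseteq> span (insert x B)"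
      proof
        fix y assume y: "y \<in> W"
        have "y - (x \<bullet> y) *\<^sub>R x \<in> W'"
          using y xW xx less.prems(1)
          by (simp add: W'_def subspace_diff subspace_mul inner_diff_right)
        then have "y - (x \<bullet> y) *\<^sub>R x \<in> span B" using B(5) by blast
        then show "y \<in> span (insert x B)" using span_insert by blast
      qed
    qed (use B in auto)
  qed
qed

lemma psd_null:
  assumes "psd X" and "x \<bullet> (X *v x) = 0"
  shows "X *v x = 0"
proof -
  have sym: "(X *v u) \<bullet> v = u \<bullet> (X *v v)" for u v
    using assms(1) by (metis psd_def dot_lmul_matrix transpose_matrix_vector)
  from nonneg_quadratic_form_null[OF matrix_vector_mul_linear[of X] sym subspace_UNIV _ UNIV_I assms(2) UNIV_I[of "X *v x"]]
  show ?thesis using assms(1) by (simp add: psd_def)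
qed

text \<open>\<open>R + sqrt l\<close> annihilates \<open>y = R b - sqrt l b\<close>, because
  \<open>R^2 b = l b\<close>. For \<open>l > 0\<close> a nonzero \<open>y\<close> would be an
  eigenvector of \<open>R\<close> with negative eigenvalue \<open>- sqrt l\<close>. For
  \<open>l = 0\<close>, symmetry gives \<open>|R b|^2 = b \<bullet> R^2 b = 0\<close>.\<close>

lemma psd_sqrt_eigenvector:
  assumes R: "psd R" and "R ** R = X" and Xb: "X *v b = l *\<^sub>R b" and "0 \<le> l"
  shows "R *v b = sqrt l *\<^sub>R b"
proof -
  let ?y = "R *v b - sqrt l *\<^sub>R b"
  have RR: "R *v (R *v b) = l *\<^sub>R b" using assms by (simp add: matrix_vector_mul_assoc)
  have sym: "(R *v u) \<bullet> v = u \<bullet> (R *v v)" for u v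
    using R by (metis psd_def dot_lmul_matrix transpose_matrix_vector)
  show ?thesis
  proof (cases "l = 0")
    case True
    then have "(R *v b) \<bullet> (R *v b) = 0" using RR by (simp add: sym)
    then show ?thesis using True by simp
  next
    case False
    have "R *v ?y = - (sqrt l *\<^sub>R ?y)"
      using RR \<open>0 \<le> l\<close> by (simp add: matrix_vector_mult_diff_distrib matrix_vector_mult_scaleR
        scaleR_diff_right)
    moreover have "0 \<le> ?y \<bullet> (R *v ?y)" using R by (simp add: psd_def)
    ultimately have "sqrt l * (?y \<bullet> ?y) \<le> 0" by simp
    then have "?y \<bullet> ?y = 0"
      using False \<open>0 \<le> l\<close> by (metis inner_ge_zero less_eq_real_def mult_le_0_iff not_less real_sqrt_gt_zero)
    then show ?thesis by simp
  qed
qed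

text \<open>On an eigenbasis of \<open>X\<close> the values of a root are forced by
  \<open>psd_sqrt_eigenvector\<close>, which gives uniqueness; prescribing these values gives
  existence.\<close>

lemma psd_sqrt_exists_unique:
  assumes X: "psd X"
  shows "\<exists>!R. psd R \<and> R ** R = X"
proof -
  have sym: "(X *v u) \<bullet> v = u \<bullet> (X *v v)" for u v
    using X by (metis psd_def dot_lmul_matrix transpose_matrix_vector)
  from self_adjoint_eigenbasis_on[OF matrix_vector_mul_linear[of X] sym subspace_UNIV]
  obtain B where B: "finite B" "pairwise orthogonal B" "\<And>b. b \<in> B \<Longrightarrow> norm b = 1"
    and "\<forall>b\<in>B. \<exists>l. X *v b = l *\<^sub>R b" and UB: "UNIV \<subseteq> span B" by auto
  then obtain l where l: "\<And>b. b \<in> B \<Longrightarrow> X *v b = l b *\<^sub>R b" by metis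
  have lnn: "0 \<le> l b" if "b \<in> B" for b
  proof -
    have "0 \<le> b \<bullet> (X *v b)" using X by (simp add: psd_def)
    then show ?thesis using l[OF that] B(3)[OF that] by (simp add: dot_square_norm)
  qed
  have ext: "R = R'" if "\<And>b. b \<in> B \<Longrightarrow> R *v b = R' *v b" for R R' :: "real^'a^'a"
  proof -
    have "R *v x = R' *v x" for x
      by (rule linear_eq_on_span[OF matrix_vector_mul_linear matrix_vector_mul_linear that])
        (use UB in auto)
    then show ?thesis by (simp add: matrix_eq)
  qed
  \<comment> \<open>The orthogonal projections onto the eigenvectors, weighted by the roots of the
    eigenvalues.\<close>
  define h where "h x = (\<Sum>b\<in>B. (sqrt (l b) * (b \<bullet> x)) *\<^sub>R b)" for x
  have h: "linear h" unfolding h_def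
    by (rule linearI) (simp_all add: inner_add_right algebra_simps sum.distrib scaleR_sum_right)
  have hb: "h b = sqrt (l b) *\<^sub>R b" if "b \<in> B" for b
  proof -
    have "h b = (\<Sum>c\<in>B. if c = b then sqrt (l b) *\<^sub>R b else 0)"
      unfolding h_def
    proof (rule sum.cong)
      fix c assume "c \<in> B"
      then show "(sqrt (l c) * (c \<bullet> b)) *\<^sub>R c = (if c = b then sqrt (l b) *\<^sub>R b else 0)"
        using that B(2) B(3)[of b] by (auto simp: pairwise_def orthogonal_def dot_square_norm)
    qed simp
    then show ?thesis using that B(1) by simp
  qed
  define R where "R = matrix h"
  have Rv: "R *v x = h x" for x using h by (simp add: R_def)
  have "(R *v u) \<bullet> v = u \<bullet> (R *v v)" for u v
    by (simp add: Rv h_def inner_sum_left inner_sum_right inner_commute mult.commute mult.left_commute)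
  then have "transpose R = R"
    by (metis adjoint_matrix adjoint_unique matrix_eq)
  moreover have "0 \<le> x \<bullet> (R *v x)" for x
  proof -
    have "x \<bullet> (R *v x) = (\<Sum>b\<in>B. sqrt (l b) * (b \<bullet> x)\<^sup>2)"
      by (simp add: Rv h_def inner_sum_right inner_commute power2_eq_square mult.assoc)
    also have "\<dots> \<ge> 0" using lnn by (simp add: sum_nonneg)
    finally show ?thesis .
  qed
  ultimately have "psd R" by (simp add: psd_def)
  moreover have "R ** R = X"
    by (rule ext) (simp add: matrix_vector_mul_assoc[symmetric] Rv hb linear_scale[OF h] l lnn)
  moreover have "R' = R" if "psd R' \<and> R' ** R' = X" for R'
    by (rule ext) (use that psd_sqrt_eigenvector[of R' X] in \<open>simp add: Rv hb l lnn\<close>)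
  ultimately show ?thesis by blast
qed

lemma psd_sqrt:
  assumes "psd X"
  shows "psd (psd_sqrt X)" and "psd_sqrt X ** psd_sqrt X = X"
  using theI'[OF psd_sqrt_exists_unique[OF assms]] by (auto simp: psd_sqrt_def)

lemma psd_sqrt_null:
  assumes "psd X" and "X *v x = 0"
  shows "psd_sqrt X *v x = 0"
  using psd_sqrt_eigenvector[OF psd_sqrt[OF assms(1)], of x 0] assms(2) by simp

section \<open>Laplacians of connected graphs\<close>

text \<open>The sum may run over all nodes, since \<open>x $ i - x $ k\<close> vanishes at
  \<open>k = i\<close> whatever \<open>w i i\<close> is.\<close>

lemma laplacian_mult_nth:
  "(laplacian w *v x) $ i = (\<Sum>k\<in>UNIV. w i k * (x $ i - x $ k))"
proof -
  have "(laplacian w *v x) $ i = (\<Sum>k\<in>UNIV. laplacian w $ i $ k * x $ k)"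
    by (simp add: matrix_vector_mult_def)
  also have "\<dots> = laplacian w $ i $ i * x $ i + (\<Sum>k\<in>UNIV - {i}. laplacian w $ i $ k * x $ k)"
    by (simp add: sum.remove)
  also have "(\<Sum>k\<in>UNIV - {i}. laplacian w $ i $ k * x $ k) = (\<Sum>k\<in>UNIV - {i}. - w i k * x $ k)"
    by (rule sum.cong) (auto simp: laplacian_def)
  also have "laplacian w $ i $ i * x $ i + \<dots> = (\<Sum>k\<in>UNIV - {i}. w i k * (x $ i - x $ k))"
    by (simp add: laplacian_def sum_distrib_left algebra_simps sum_subtractf sum_negf)
  also have "\<dots> = (\<Sum>k\<in>UNIV. w i k * (x $ i - x $ k))"
    by (simp add: sum.remove[of UNIV i])
  finally show ?thesis .
qed

text \<open>Average the double sum with its copy under exchange of the two indices; each edge is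
  counted twice, whence the division by 2.\<close>

lemma laplacian_quadratic_form:
  assumes "weighted_graph w"
  shows "x \<bullet> (laplacian w *v x) = (\<Sum>i\<in>UNIV. \<Sum>k\<in>UNIV. w i k * (x $ i - x $ k)\<^sup>2) / 2"
proof -
  let ?t = "\<lambda>i k. w i k * (x $ i - x $ k)"
  have eq: "x \<bullet> (laplacian w *v x) = (\<Sum>i\<in>UNIV. \<Sum>k\<in>UNIV. x $ i * ?t i k)"
    by (simp add: inner_vec_def laplacian_mult_nth sum_distrib_left)
  also have "\<dots> = (\<Sum>i\<in>UNIV. \<Sum>k\<in>UNIV. x $ k * ?t k i)" by (rule sum.swap)
  also have "\<dots> = (\<Sum>i\<in>UNIV. \<Sum>k\<in>UNIV. - (x $ k * ?t i k))"
  proof (intro sum.cong refl)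
    fix i k
    show "x $ k * ?t k i = - (x $ k * ?t i k)"
      using assms by (cases "i = k") (auto simp: weighted_graph_def algebra_simps)
  qed
  finally have "2 * (x \<bullet> (laplacian w *v x)) =
      (\<Sum>i\<in>UNIV. \<Sum>k\<in>UNIV. x $ i * ?t i k) + (\<Sum>i\<in>UNIV. \<Sum>k\<in>UNIV. - (x $ k * ?t i k))"
    using eq by simp
  also have "\<dots> = (\<Sum>i\<in>UNIV. \<Sum>k\<in>UNIV. w i k * (x $ i - x $ k)\<^sup>2)"
    by (simp add: sum.distrib[symmetric] power2_eq_square algebra_simps)
  finally show ?thesis by simp
qed

lemma transpose_laplacian:
  assumes "weighted_graph w"
  shows "transpose (laplacian w) = laplacian w"
  using assms by (auto simp: vec_eq_iff transpose_def laplacian_def weighted_graph_def)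

lemma psd_laplacian:
  assumes "weighted_graph w"
  shows "psd (laplacian w)"
  unfolding psd_def
proof (intro conjI allI transpose_laplacian[OF assms])
  fix x
  have "0 \<le> w i k * (x $ i - x $ k)\<^sup>2" for i k
    using assms by (cases "i = k") (auto simp: weighted_graph_def)
  then show "0 \<le> x \<bullet> (laplacian w *v x)"
    by (simp add: laplacian_quadratic_form[OF assms] sum_nonneg)
qed

text \<open>The quadratic form is a sum of nonnegative terms, so a kernel vector agrees across every
  edge of positive weight, and then along paths.\<close>

lemma laplacian_null_const:
  assumes w: "weighted_graph w" "connected_graph w"
    and "laplacian w *v x = 0"
  shows "x $ i = x $ j"
proof -
  have nn: "0 \<le> w i k * (x $ i - x $ k)\<^sup>2" for i k
    using w by (cases "i = k") (auto simp: weighted_graph_def)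
  have "(\<Sum>i\<in>UNIV. \<Sum>k\<in>UNIV. w i k * (x $ i - x $ k)\<^sup>2) = 0"
    using laplacian_quadratic_form[OF w(1), of x] assms(3) by simp
  then have "w k l * (x $ k - x $ l)\<^sup>2 = 0" for k l
    using nn by (simp add: sum_nonneg_eq_0_iff sum_nonneg del: mult_eq_0_iff)
  then have edge: "x $ k = x $ l" if "0 < w k l" for k l
    using that by (metis eq_iff_diff_eq_0 less_irrefl mult_eq_0_iff power_eq_0_iff)
  have "(i, j) \<in> {(k, l). k \<noteq> l \<and> 0 < w k l}\<^sup>*"
    using w(2) by (simp add: connected_graph_def)
  then show ?thesis by (induction rule: rtrancl_induct) (auto dest: edge)
qed

lemma laplacian_mult_const [simp]: "laplacian w *v (\<chi> i. c) = 0"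
  by (simp add: vec_eq_iff laplacian_mult_nth)

section \<open>Matrix identities\<close>

lemma diag_nth: "diag u $ i $ j = (if i = j then u $ i else 0)"
  by (simp add: diag_def)

lemma diag_mult_nth [simp]: "(diag u ** Y) $ i $ j = u $ i * Y $ i $ j"
  by (simp add: matrix_matrix_mult_def diag_def if_distrib[of "\<lambda>a. a * _"] cong: if_cong)

lemma mult_diag_nth [simp]: "(Y ** diag u) $ i $ j = Y $ i $ j * u $ j"
  by (simp add: matrix_matrix_mult_def diag_def if_distrib[of "\<lambda>a. _ * a"] cong: if_cong)

lemma symmetric_nth: "transpose X = X \<Longrightarrow> X $ i $ j = X $ j $ i"
  by (drule arg_cong[of _ _ "\<lambda>Y. Y $ j $ i"]) (simp add: transpose_def)

lemma matrix_add_rdistrib: "(A + B) ** C = A ** C + B ** (C :: real^'c^'b)"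
  by (simp add: vec_eq_iff matrix_matrix_mult_def sum.distrib distrib_right)

lemma matrix_inv_diag:
  assumes "\<forall>i. m $ i \<noteq> 0"
  shows "matrix_inv (diag m) = diag (\<chi> i. 1 / m $ i)"
proof -
  have "diag m ** diag (\<chi> i. 1 / m $ i) = mat 1" "diag (\<chi> i. 1 / m $ i) ** diag m = mat 1"
    using assms by (auto simp: vec_eq_iff mat_def) (auto simp: diag_def)
  then have "matrix_inv (diag m) ** diag m = mat 1" "diag m ** diag (\<chi> i. 1 / m $ i) = mat 1"
    unfolding matrix_inv_def by (metis (mono_tags, lifting) someI_ex)+
  then show ?thesis by (metis matrix_mul_assoc matrix_mul_lid matrix_mul_rid)
qed

lemma sum_UNIV_Plus:
  fixes f :: "'a::finite + 'b::finite \<Rightarrow> 'c::comm_monoid_add"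
  shows "(\<Sum>k\<in>UNIV. f k) = (\<Sum>i\<in>UNIV. f (Inl i)) + (\<Sum>i\<in>UNIV. f (Inr i))"
  by (simp add: UNIV_Plus_UNIV[symmetric] sum.Plus del: UNIV_Plus_UNIV)

lemma matrix_mult_uminus_left: "(- A) ** B = - (A ** (B :: real^'c^'b))"
  by (simp add: vec_eq_iff matrix_matrix_mult_def sum_negf)

lemma matrix_mult_uminus_right: "A ** (- B) = - (A ** (B :: real^'c^'b))"
  by (simp add: vec_eq_iff matrix_matrix_mult_def sum_negf)

lemma trace_uminus: "trace (- A) = - trace (A :: real^'b^'b)"
  by (simp add: trace_def sum_negf)

lemma trace_transpose: "trace (transpose A) = trace A"
  by (simp add: trace_def transpose_def)

text \<open>For nonnegative \<open>r\<close> and positive semidefinite \<open>G\<close> every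
  summand is nonnegative; both dissipation estimates below reduce to this shape.\<close>

lemma trace_quadratic_diag:
  "trace (transpose H ** G ** H ** diag r) =
    (\<Sum>j\<in>UNIV. r $ j * (column j H \<bullet> (G *v column j H)))"
proof -
  have "(transpose H ** G ** H) $ j $ j = column j H \<bullet> (G *v column j H)" for j
    by (simp add: matrix_mul_assoc[symmetric] matrix_mult_transpose_dot_column)
      (simp add: inner_vec_def matrix_matrix_mult_def matrix_vector_mult_def transpose_def column_def)
  then show ?thesis by (simp add: trace_def mult.commute)
qed

section \<open>Uniqueness for the Lyapunov equation\<close>

text \<open>
  In the coordinates given by a square root of \<open>E\<close>, the operator \<open>A\<close> is a skew part minus the
  dissipation \<open>diag r\<close>. Pairing \<open>P A + A\<^sup>T P = 0\<close> with \<open>P\<close> in the trace form weighted by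
  \<open>G = E\<^sup>-\<^sup>1\<close> kills the skew part, so the dissipation of \<open>P\<close> vanishes.
\<close>

lemma homogeneous_lyapunov:
  fixes A E P :: "real^'k^'k" and r :: "real^'k"
  assumes Esym: "transpose E = E" and Epos: "\<And>x. x \<noteq> 0 \<Longrightarrow> 0 < x \<bullet> (E *v x)"
    and r: "\<And>j. 0 \<le> r $ j"
    and EA: "E ** A + transpose A ** E = - diag r"
    and PA: "P ** A + transpose A ** P = 0"
  obtains X where "P = E ** X" and "X ** A = A ** X" and "\<And>j. 0 < r $ j \<Longrightarrow> row j X = 0"
proof -
  have "x = 0" if "E *v x = 0" for x
    using Epos[of x] that by force
  then obtain G where GE: "G ** E = mat 1"
    using matrix_left_invertible_ker[of E] by blast
  then have EG: "E ** G = mat 1" by (simp add: matrix_left_right_inverse)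
  have Gsym: "transpose G = G"
  proof -
    have "transpose G ** E = mat 1" by (metis EG Esym matrix_transpose_mul transpose_mat)
    then show ?thesis by (metis EG matrix_mul_assoc matrix_mul_lid matrix_mul_rid)
  qed
  have Gpos: "0 < x \<bullet> (G *v x)" if "x \<noteq> 0" for x
  proof -
    have x: "x = E *v (G *v x)" by (simp add: matrix_vector_mul_assoc EG)
    then have "G *v x \<noteq> 0" using that by auto
    from Epos[OF this] show ?thesis using x by (metis inner_commute)
  qed
  have Gnn: "0 \<le> x \<bullet> (G *v x)" for x using Gpos[of x] by (cases "x = 0") auto
  define R where "R = diag r"
  \<comment> \<open>The energy identity multiplied by \<open>G\<close> on both sides:
    \<open>A ** G\<close> is skew up to the dissipation.\<close>
  have AG: "A ** G + G ** transpose A = - (G ** R ** G)"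
  proof -
    have "G ** (E ** A + transpose A ** E) ** G = A ** G + G ** transpose A"
      by (simp add: matrix_add_ldistrib matrix_add_rdistrib matrix_mul_assoc GE)
        (simp add: matrix_mul_assoc[symmetric] EG)
    then show ?thesis by (simp add: EA R_def matrix_mult_uminus_left matrix_mult_uminus_right)
  qed
  define X where "X = G ** P"
  \<comment> \<open>\<open>t1\<close> and \<open>t2\<close> are the two summands of the equation,
    paired with \<open>P\<close>. They add up to zero and each is at most zero, so
    \<open>t2 = 0\<close>.\<close>
  define t1 where "t1 = trace (transpose P ** G ** P ** A ** G)"
  define t2 where "t2 = trace (transpose P ** G ** transpose A ** P ** G)"
  have "transpose P ** G ** (P ** A + transpose A ** P) ** G = 0"
    by (simp add: PA)
  then have "t1 + t2 = 0"
    unfolding t1_def t2_def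
    by (simp add: trace_add[symmetric] matrix_add_ldistrib matrix_add_rdistrib matrix_mul_assoc)
      (simp add: trace_def)
  \<comment> \<open>Transposition and cyclicity replace \<open>A ** G\<close> by
    \<open>G ** transpose A\<close>; adding both forms leaves only the dissipation.\<close>
  have "t1 = trace (transpose P ** G ** P ** G ** transpose A)"
  proof -
    have "t1 = trace (transpose (transpose P ** G ** P ** A ** G))"
      by (simp only: t1_def trace_transpose)
    also have "\<dots> = trace ((G ** transpose A) ** (transpose P ** G ** P))"
      by (simp add: matrix_transpose_mul Gsym matrix_mul_assoc)
    also have "\<dots> = trace ((transpose P ** G ** P) ** (G ** transpose A))"
      by (rule trace_mul_sym)
    finally show ?thesis by (simp add: matrix_mul_assoc)
  qed
  then have "2 * t1 = trace (transpose P ** G ** P ** (A ** G + G ** transpose A))"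
    unfolding t1_def by (simp add: matrix_add_ldistrib trace_add matrix_mul_assoc)
  also have "\<dots> = - trace ((transpose P ** G ** P ** G ** R) ** G)"
    by (simp add: AG matrix_mult_uminus_right trace_uminus matrix_mul_assoc)
  also have "\<dots> = - trace (transpose (P ** G) ** G ** (P ** G) ** R)"
    by (subst trace_mul_sym) (simp add: matrix_transpose_mul Gsym matrix_mul_assoc)
  also have "\<dots> \<le> 0"
    unfolding R_def trace_quadratic_diag using r Gnn by (simp add: sum_nonneg)
  finally have "t1 \<le> 0" by simp
  have t2a: "t2 = trace (P ** G ** transpose P ** (G ** transpose A))"
    unfolding t2_def
    using trace_mul_sym[of "transpose P ** G ** transpose A" "P ** G"]
    by (simp add: matrix_mul_assoc)
  also have "\<dots> = trace (transpose (P ** G ** transpose P ** (G ** transpose A)))"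
    by (simp only: trace_transpose)
  also have "\<dots> = trace ((A ** G) ** (P ** G ** transpose P))"
    by (simp add: matrix_transpose_mul Gsym matrix_mul_assoc)
  also have "\<dots> = trace ((P ** G ** transpose P) ** (A ** G))" by (rule trace_mul_sym)
  finally have "2 * t2 = trace (P ** G ** transpose P ** (A ** G + G ** transpose A))"
    using t2a by (simp add: matrix_add_ldistrib trace_add)
  also have "\<dots> = - trace ((P ** G ** transpose P ** G ** R) ** G)"
    by (simp add: AG matrix_mult_uminus_right trace_uminus matrix_mul_assoc)
  also have "\<dots> = - trace (transpose (transpose X) ** G ** transpose X ** R)"
    by (subst trace_mul_sym) (simp add: X_def matrix_transpose_mul Gsym matrix_mul_assoc)
  \<comment> \<open>Here the dissipation acts on the rows of \<open>X\<close>, so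
    \<open>t2 = 0\<close> annihilates every row with \<open>0 < r $ j\<close>.\<close>
  finally have t2X: "2 * t2 = - (\<Sum>j\<in>UNIV. r $ j * (row j X \<bullet> (G *v row j X)))"
    unfolding R_def trace_quadratic_diag by simp
  then have "t2 \<le> 0" using r Gnn by (smt (verit) mult_nonneg_nonneg sum_nonneg)
  with \<open>t1 \<le> 0\<close> \<open>t1 + t2 = 0\<close> have "t2 = 0" by simp
  with t2X have "(\<Sum>j\<in>UNIV. r $ j * (row j X \<bullet> (G *v row j X))) = 0" by simp
  then have "r $ j * (row j X \<bullet> (G *v row j X)) = 0" for j
    using r Gnn by (simp add: sum_nonneg_eq_0_iff del: mult_eq_0_iff)
  then have rows: "row j X = 0" if "0 < r $ j" for j
    using that Gpos[of "row j X"] by (metis less_irrefl mult_eq_0_iff)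
  have RX: "R ** X = 0"
  proof -
    have "r $ j * X $ j $ k = 0" for j k
      using rows[of j] r[of j] by (cases "r $ j = 0") (auto simp: row_def vec_eq_iff)
    then show ?thesis by (simp add: R_def vec_eq_iff)
  qed
  \<comment> \<open>Since \<open>R ** X = 0\<close>, the dissipation drops out of \<open>AG\<close>
    applied to \<open>P\<close>; the equation for \<open>P\<close> then turns
    \<open>- (transpose A ** P)\<close> into \<open>P ** A\<close>.\<close>
  have "A ** X = (A ** G + G ** transpose A) ** P - G ** (transpose A ** P)"
    by (simp add: X_def matrix_add_rdistrib matrix_mul_assoc)
  also have "\<dots> = - (G ** (transpose A ** P))"
    using RX by (simp add: AG matrix_mult_uminus_left matrix_mul_assoc[symmetric] X_def)
  also have "\<dots> = G ** (- (transpose A ** P))" by (simp add: matrix_mult_uminus_right)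
  also have "- (transpose A ** P) = P ** A" using PA by (simp add: add_eq_0_iff2)
  finally have "X ** A = A ** X" by (simp add: X_def matrix_mul_assoc)
  moreover have "P = E ** X" by (simp add: X_def matrix_mul_assoc EG)
  ultimately show ?thesis using rows by (intro that[of X])
qed

section \<open>The network dynamics: left kernel, energy and uniqueness\<close>

lemma sysA_nth:
  assumes "\<forall>i. 0 < m $ i"
  shows "sysA L d m $ Inl i $ Inl j = 0"
    and "sysA L d m $ Inl i $ Inr j = (if i = j then 1 else 0)"
    and "sysA L d m $ Inr i $ Inl j = - (L $ i $ j / m $ i)"
    and "sysA L d m $ Inr i $ Inr j = (if i = j then - (d $ i / m $ i) else 0)"
  using assms by (simp_all add: sysA_def block22_def mat_def matrix_inv_diag less_imp_neq[symmetric])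
    (simp add: diag_def)

text \<open>The susceptances enter only through a positive semidefinite \<open>L\<close> whose
  kernel consists exactly of the constant vectors.\<close>

locale connected_network =
  fixes L :: "real^'n::finite^'n" and d :: "real^'n"
  assumes psd_L: "psd L"
    and ker_L: "\<And>x i j. L *v x = 0 \<Longrightarrow> x $ i = x $ j"
    and L_const: "\<And>c. L *v (\<chi> i. c) = 0"
    and d: "\<forall>i. 0 < d $ i"
begin

lemma L_sym: "L $ i $ j = L $ j $ i"
  using psd_L by (intro symmetric_nth) (simp add: psd_def)

text \<open>Such a \<open>c\<close> is a conserved linear functional. The velocity columns express
  its position part as \<open>d\<close> times \<open>?x\<close>, the velocity part divided by
  \<open>m\<close>; by symmetry of \<open>L\<close> the position columns give
  \<open>L *v ?x = 0\<close>, so \<open>?x\<close> is constant.\<close>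

lemma sysA_left_null:
  assumes m: "\<forall>i. 0 < m $ i" and c: "c v* sysA L d m = 0"
  obtains k where "\<And>i. c $ Inl i = k * d $ i" and "\<And>i. c $ Inr i = k * m $ i"
proof -
  let ?x = "\<chi> i. c $ Inr i / m $ i"
  have "(c v* sysA L d m) $ Inl j = - (L *v ?x) $ j" for j
    by (simp add: vector_matrix_mult_def sum_UNIV_Plus sysA_nth[OF m] matrix_vector_mult_def
        L_sym[of _ j] sum_negf algebra_simps)
  then have "L *v ?x = 0" using c by (simp add: vec_eq_iff)
  \<comment> \<open>\<open>undefined\<close> serves as an arbitrary reference node.\<close>
  then have eq: "?x $ i = ?x $ undefined" for i by (rule ker_L)
  have "(c v* sysA L d m) $ Inr j = c $ Inl j - d $ j * ?x $ j" for j
    by (simp add: vector_matrix_mult_def sum_UNIV_Plus sysA_nth[OF m]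
        if_distrib[of "\<lambda>a. _ * a"] cong: if_cong)
  then have "c $ Inl j = ?x $ j * d $ j" for j
    using c by (simp add: vec_eq_iff)
  moreover have "c $ Inr j = ?x $ j * m $ j" for j using m by (simp add: less_imp_neq[symmetric])
  ultimately show ?thesis using eq by (intro that[of "?x $ undefined"]) metis+
qed

text \<open>Pairing with \<open>z0\<close> gives \<open>k\<close> times the total damping, which is
  positive.\<close>

lemma sysA_left_null_eq_0:
  assumes m: "\<forall>i. 0 < m $ i" and c: "c v* sysA L d m = 0" and "c \<bullet> z0 = 0"
  shows "c = 0"
proof -
  obtain k where k: "\<And>i. c $ Inl i = k * d $ i" "\<And>i. c $ Inr i = k * m $ i"
    using sysA_left_null[OF m c] by metis
  have "k * (\<Sum>i\<in>UNIV. d $ i) = 0"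
    using \<open>c \<bullet> z0 = 0\<close> by (simp add: inner_vec_def sum_UNIV_Plus z0_def k sum_distrib_left)
  moreover have "(\<Sum>i\<in>UNIV. d $ i) > 0" using d by (simp add: sum_pos)
  ultimately have "k = 0" by simp
  then have "c $ i = 0" for i using k by (cases i) auto
  then show ?thesis by (simp add: vec_eq_iff)
qed

text \<open>
  The energy \<open>x \<bullet> L x + y \<bullet> M y\<close> is only semidefinite; adding the square of the functional
  \<open>d \<bullet> x + m \<bullet> y\<close>, which is conserved along the dynamics, makes it definite without changing
  its dissipation.
\<close>

lemma sysA_energy:
  assumes m: "\<forall>i. 0 < m $ i"
  obtains E where "transpose E = E" and "\<And>z. z \<noteq> 0 \<Longrightarrow> 0 < z \<bullet> (E *v z)"
    and "E ** sysA L d m + transpose (sysA L d m) ** E =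
      - diag (\<chi> k. case k of Inl _ \<Rightarrow> 0 | Inr i \<Rightarrow> 2 * d $ i)"
proof -
  let ?A = "sysA L d m"
  \<comment> \<open>The conserved functional of \<open>sysA_left_null\<close> with
    \<open>k = 1\<close>; \<open>W\<close> is the matrix of its square.\<close>
  define w where "w = (\<chi> k. case k of Inl i \<Rightarrow> d $ i | Inr i \<Rightarrow> m $ i)"
  define W where "W = (\<chi> i j. w $ i * w $ j)"
  define E0 where "E0 = block22 L 0 0 (diag m)"
  have "E0 $ i $ j = E0 $ j $ i" for i j
    by (cases i; cases j) (auto simp: E0_def block22_def L_sym diag_def)
  then have E0sym: "transpose E0 = E0" by (simp add: transpose_def vec_eq_iff)
  have Wsym: "transpose W = W" by (simp add: transpose_def W_def vec_eq_iff mult.commute)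
  have "w v* ?A = 0"
  proof -
    have "(w v* ?A) $ Inl j = - (L *v (\<chi> i. 1)) $ j" for j
      using m by (simp add: vector_matrix_mult_def sum_UNIV_Plus sysA_nth[OF m] w_def
        matrix_vector_mult_def L_sym[of _ j] sum_negf less_imp_neq[symmetric])
    moreover have "(w v* ?A) $ Inr j = 0" for j
      using m by (simp add: vector_matrix_mult_def sum_UNIV_Plus sysA_nth[OF m] w_def
        if_distrib[of "\<lambda>a. _ * a"] less_imp_neq[symmetric] cong: if_cong)
    ultimately have "(w v* ?A) $ k = 0" for k by (cases k) (auto simp: L_const)
    then show ?thesis by (simp add: vec_eq_iff)
  qed
  then have "(\<Sum>k\<in>UNIV. w $ k * ?A $ k $ j) = 0" for j
    by (simp add: vec_eq_iff vector_matrix_mult_def mult.commute)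
  then have WA: "W ** ?A = 0"
    by (simp add: W_def vec_eq_iff matrix_matrix_mult_def mult.assoc sum_distrib_left[symmetric])
  have AW: "transpose ?A ** W = 0"
  proof -
    have "transpose ?A ** W = transpose (W ** ?A)" by (simp add: matrix_transpose_mul Wsym)
    then show ?thesis by (simp add: WA transpose_def vec_eq_iff)
  qed
  \<comment> \<open>The blocks \<open>L\<close> and \<open>- L\<close> cancel on adding the
    transpose, so only the damping remains.\<close>
  have E0A: "(E0 ** ?A) $ k $ l = block22 0 L (- L) (- diag d) $ k $ l" for k l
    using m by (cases k; cases l)
      (auto simp: matrix_matrix_mult_def sum_UNIV_Plus sysA_nth[OF m] E0_def block22_def diag_def
        if_distrib[of "\<lambda>a. a * _"] if_distrib[of "\<lambda>a. _ * a"] less_imp_neq[symmetric] cong: if_cong)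
  have "transpose ?A ** E0 = transpose (E0 ** ?A)" by (simp add: matrix_transpose_mul E0sym)
  then have "(E0 ** ?A + transpose ?A ** E0) $ k $ l =
      (- diag (\<chi> k. case k of Inl _ \<Rightarrow> 0 | Inr i \<Rightarrow> 2 * d $ i)) $ k $ l" for k l
    by (cases k; cases l) (auto simp: E0A transpose_def block22_def diag_def L_sym)
  then have E0A': "E0 ** ?A + transpose ?A ** E0 =
      - diag (\<chi> k. case k of Inl _ \<Rightarrow> 0 | Inr i \<Rightarrow> 2 * d $ i)"
    by (simp add: vec_eq_iff)
  have pos: "0 < z \<bullet> ((E0 + W) *v z)" if "z \<noteq> 0" for z
  proof -
    define x y where "x = (\<chi> i. z $ Inl i)" and "y = (\<chi> i. z $ Inr i)"
    have "(W *v z) $ k = w $ k * (w \<bullet> z)" for k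
      by (simp add: W_def matrix_vector_mult_def inner_vec_def sum_distrib_left mult.assoc)
    then have zWz: "z \<bullet> (W *v z) = (w \<bullet> z)\<^sup>2"
      by (simp add: inner_vec_def[of z] power2_eq_square sum_distrib_right[symmetric]
        mult.assoc[symmetric]) (simp add: inner_vec_def mult.commute)
    have "(E0 *v z) $ Inl i = (L *v x) $ i" for i
      by (simp add: E0_def block22_def x_def matrix_vector_mult_def sum_UNIV_Plus)
    moreover have "(E0 *v z) $ Inr i = m $ i * y $ i" for i
      by (simp add: E0_def block22_def y_def matrix_vector_mult_def sum_UNIV_Plus diag_def
        if_distrib[of "\<lambda>a. a * _"] cong: if_cong)
    ultimately have "z \<bullet> (E0 *v z) = x \<bullet> (L *v x) + (\<Sum>i\<in>UNIV. m $ i * (y $ i)\<^sup>2)"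
      by (simp add: inner_vec_def sum_UNIV_Plus x_def y_def power2_eq_square algebra_simps)
    then have eq: "z \<bullet> ((E0 + W) *v z) =
        x \<bullet> (L *v x) + (\<Sum>i\<in>UNIV. m $ i * (y $ i)\<^sup>2) + (w \<bullet> z)\<^sup>2"
      by (simp add: matrix_vector_mult_add_rdistrib inner_add_right zWz)
    have nn: "0 \<le> x \<bullet> (L *v x)" "0 \<le> (\<Sum>i\<in>UNIV. m $ i * (y $ i)\<^sup>2)" "0 \<le> (w \<bullet> z)\<^sup>2"
      using psd_L m by (auto simp: psd_def less_imp_le intro!: sum_nonneg)
    show ?thesis
    proof (rule ccontr)
      assume "\<not> ?thesis"
      \<comment> \<open>Zero kinetic energy gives \<open>y = 0\<close>, zero potential energy makes
        \<open>x\<close> constant, and \<open>w \<bullet> z\<close> is then the total damping times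
        that constant.\<close>
      then have z: "x \<bullet> (L *v x) = 0" "(\<Sum>i\<in>UNIV. m $ i * (y $ i)\<^sup>2) = 0" "(w \<bullet> z)\<^sup>2 = 0"
        using eq nn by linarith+
      from z(2) have "m $ i * (y $ i)\<^sup>2 = 0" for i
        using m by (subst (asm) sum_nonneg_eq_0_iff) (auto simp: less_imp_le)
      then have y: "y $ i = 0" for i using m by (metis less_irrefl mult_eq_0_iff power_eq_0_iff)
      have x: "x $ i = x $ undefined" for i
        using psd_null[OF psd_L z(1)] by (rule ker_L)
      have "(\<Sum>i\<in>UNIV. d $ i) * x $ undefined = (\<Sum>i\<in>UNIV. d $ i * x $ i)"
        unfolding sum_distrib_right using x by metis
      also have "\<dots> = w \<bullet> z"
        using y by (simp add: inner_vec_def sum_UNIV_Plus w_def x_def y_def)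
      finally have "(\<Sum>i\<in>UNIV. d $ i) * x $ undefined = 0" using z by simp
      moreover have "(\<Sum>i\<in>UNIV. d $ i) > 0" using d by (simp add: sum_pos)
      ultimately have "x $ i = 0" for i using x[of i] by simp
      then have "z $ k = 0" for k using y by (cases k) (auto simp: x_def y_def)
      then show False using that by (simp add: vec_eq_iff)
    qed
  qed
  show ?thesis
  proof (rule that[of "E0 + W"])
    show "transpose (E0 + W) = E0 + W"
      using E0sym Wsym by (simp add: transpose_def vec_eq_iff)
    show "(E0 + W) ** ?A + transpose ?A ** (E0 + W) =
        - diag (\<chi> k. case k of Inl _ \<Rightarrow> 0 | Inr i \<Rightarrow> 2 * d $ i)"
      by (simp add: matrix_add_ldistrib matrix_add_rdistrib WA AW E0A')
  qed (rule pos)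
qed

text \<open>\<open>homogeneous_lyapunov\<close> gives \<open>P = E ** X\<close>, where
  \<open>X\<close> commutes with the system matrix and has zero velocity rows. The position rows of
  the product of the system matrix with \<open>X\<close> are the velocity rows of \<open>X\<close>,
  so each position row of \<open>X\<close> is a left null vector. It is orthogonal to
  \<open>z0\<close> because \<open>E\<close> is injective, hence zero.\<close>

lemma lyapunov_unique:
  assumes m: "\<forall>i. 0 < m $ i"
    and PA: "P ** sysA L d m + transpose (sysA L d m) ** P = 0" and Pz: "P *v z0 = 0"
  shows "P = 0"
proof -
  let ?A = "sysA L d m"
  obtain E where E: "transpose E = E" "\<And>z. z \<noteq> 0 \<Longrightarrow> 0 < z \<bullet> (E *v z)"
    "E ** ?A + transpose ?A ** E = - diag (\<chi> k. case k of Inl _ \<Rightarrow> 0 | Inr i \<Rightarrow> 2 * d $ i)"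
    using sysA_energy[OF m] by metis
  have r: "0 \<le> (\<chi> k. case k of Inl _ \<Rightarrow> 0 | Inr i \<Rightarrow> 2 * d $ i) $ j" for j :: "'n + 'n"
    using d by (cases j) (auto simp: less_imp_le)
  obtain X where X: "P = E ** X" "X ** ?A = ?A ** X"
    "\<And>j. 0 < (\<chi> k. case k of Inl _ \<Rightarrow> 0 | Inr i \<Rightarrow> 2 * d $ i) $ j \<Longrightarrow> row j X = 0"
    using homogeneous_lyapunov[OF E(1,2) r E(3) PA] by metis
  have XInr: "X $ Inr i $ k = 0" for i k
    using X(3)[of "Inr i"] d by (simp add: row_def vec_eq_iff)
  have "(?A ** X) $ Inr i $ k = 0" for i k
    unfolding X(2)[symmetric] by (simp add: matrix_matrix_mult_def XInr)
  moreover have "(?A ** X) $ Inr i $ k = - ((L *v (\<chi> j. X $ Inl j $ k)) $ i / m $ i)" for i k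
    by (simp add: matrix_matrix_mult_def matrix_vector_mult_def sum_UNIV_Plus sysA_nth[OF m] XInr
      sum_negf sum_divide_distrib)
  ultimately have "L *v (\<chi> j. X $ Inl j $ k) = 0" for k
    using m by (simp add: vec_eq_iff less_imp_neq[symmetric])
  from ker_L[OF this] have Xeq: "X $ Inl i $ k = X $ Inl j $ k" for i j k by simp
  have "row (Inl i) X = 0" for i
  proof (rule sysA_left_null_eq_0[OF m])
    have "(row (Inl i) X v* ?A) $ k = (?A ** X) $ Inl i $ k" for k
      unfolding X(2)[symmetric]
      by (simp add: matrix_matrix_mult_def vector_matrix_mult_def row_def mult.commute)
    moreover have "(?A ** X) $ Inl i $ k = 0" for k
      by (simp add: matrix_matrix_mult_def sum_UNIV_Plus sysA_nth[OF m] XInr)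
    ultimately show "row (Inl i) X v* ?A = 0" by (simp add: vec_eq_iff)
    have "E *v (X *v z0) = 0" using Pz X(1) by (simp add: matrix_vector_mul_assoc)
    then have "X *v z0 = 0" using E(2)[of "X *v z0"] by force
    then show "row (Inl i) X \<bullet> z0 = 0"
      by (simp add: vec_eq_iff matrix_vector_mult_def row_def inner_vec_def)
  qed
  then have "X $ k $ l = 0" for k l by (cases k) (auto simp: XInr row_def vec_eq_iff)
  then have "X = 0" by (simp add: vec_eq_iff)
  then show ?thesis using X(1) by simp
qed

end

section \<open>Derivative of the solution\<close>

lemma bounded_bilinear_matrix_mult:
  "bounded_bilinear (\<lambda>(A :: real^'b^'a) (B :: real^'c^'b). A ** B)"
proof -
  have "bilinear (\<lambda>(A :: real^'b^'a) (B :: real^'c^'b). A ** B)"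
    unfolding bilinear_def
    by (auto intro!: linearI simp: vec_eq_iff matrix_matrix_mult_def algebra_simps sum.distrib sum_distrib_left)
  then show ?thesis by (simp add: bilinear_conv_bounded_bilinear)
qed

lemma bounded_linear_transpose: "bounded_linear (transpose :: real^'b^'a \<Rightarrow> real^'a^'b)"
  unfolding linear_conv_bounded_linear[symmetric]
  by (rule linearI) (simp_all add: vec_eq_iff transpose_def)

lemma bounded_linear_trace: "bounded_linear (trace :: real^'a^'a \<Rightarrow> real)"
  unfolding linear_conv_bounded_linear[symmetric]
  by (rule linearI) (simp_all add: trace_def sum.distrib sum_distrib_left)

lemma bounded_bilinear_lyapunov:
  "bounded_bilinear (\<lambda>(A :: real^'a^'a) P. P ** A + transpose A ** P)"
  unfolding bilinear_conv_bounded_bilinear[symmetric] bilinear_def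
  by (auto intro!: linearI simp: vec_eq_iff matrix_matrix_mult_def transpose_def algebra_simps
    sum.distrib sum_distrib_left)

lemma linear_lyapunov: "linear (\<lambda>P :: real^'a^'a. P ** A + transpose A ** P)"
  using bounded_bilinear.bounded_linear_right[OF bounded_bilinear_lyapunov]
  by (rule bounded_linear.linear)

text \<open>Implicit differentiation without assuming \<open>P\<close> continuous: the identity
  first bounds \<open>P y\<close> near \<open>m\<close>, then yields continuity, and finally lets
  \<open>P y\<close> be replaced by \<open>P m\<close> up to higher order.\<close>

lemma has_derivative_fixed_point_perturbation:
  fixes B :: "'a::real_normed_vector \<Rightarrow> 'b::real_normed_vector \<Rightarrow> 'b"
    and \<alpha> :: "'d::real_normed_vector \<Rightarrow> 'a"
  assumes B: "bounded_bilinear B" and \<alpha>: "(\<alpha> has_derivative \<alpha>') (at m)"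
    and ev: "\<forall>\<^sub>F y in at m. P y = P m - B (\<alpha> y - \<alpha> m) (P y)"
  shows "(P has_derivative (\<lambda>h. - B (\<alpha>' h) (P m))) (at m)"
proof -
  interpret B: bounded_bilinear B by (rule B)
  obtain K where K: "K > 0" "\<And>a x. norm (B a x) \<le> norm a * norm x * K"
    using B.pos_bounded by blast
  have "bounded_linear \<alpha>'" using \<alpha> by (rule has_derivative_bounded_linear)
  then obtain K' where K': "K' > 0" "\<And>h. norm (\<alpha>' h) \<le> norm h * K'"
    using bounded_linear.pos_bounded by blast
  have "(\<alpha> \<longlongrightarrow> \<alpha> m) (at m)"
    using has_derivative_continuous[OF \<alpha>] by (simp add: continuous_within)
  then have lim: "((\<lambda>y. \<alpha> y - \<alpha> m) \<longlongrightarrow> 0) (at m)" by (simp add: LIM_zero)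
  \<comment> \<open>The threshold makes the \<open>B\<close> term at most half of
    \<open>norm (P y)\<close>, whence \<open>norm (P y) \<le> 2 * norm (P m)\<close>.\<close>
  then have "\<forall>\<^sub>F y in at m. norm (\<alpha> y - \<alpha> m) < 1 / (2 * K)"
    using K(1) by (auto simp: tendsto_iff)
  with ev have "\<forall>\<^sub>F y in at m. norm (P y - P m) \<le> norm (\<alpha> y - \<alpha> m) * (2 * norm (P m) * K)"
  proof eventually_elim
    case (elim y)
    have "P y - P m = - B (\<alpha> y - \<alpha> m) (P y)" using elim(1) by (simp add: algebra_simps)
    then have eq: "norm (P y - P m) \<le> norm (\<alpha> y - \<alpha> m) * norm (P y) * K" using K(2) by simp
    have "norm (\<alpha> y - \<alpha> m) * norm (P y) * K = (norm (\<alpha> y - \<alpha> m) * K) * norm (P y)"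
      by simp
    also have "\<dots> \<le> 1 / 2 * norm (P y)"
      using elim(2) K(1) by (intro mult_right_mono) (auto simp: field_simps)
    finally have "norm (P y - P m) \<le> norm (P y) / 2" using eq by linarith
    then have "norm (P y) \<le> 2 * norm (P m)"
      using norm_triangle_ineq2[of "P y" "P m"] by linarith
    then have "norm (\<alpha> y - \<alpha> m) * norm (P y) * K \<le> norm (\<alpha> y - \<alpha> m) * (2 * norm (P m)) * K"
      using K(1) by (intro mult_right_mono mult_left_mono) auto
    then show ?case using eq by (simp add: mult.assoc)
  qed
  moreover have "((\<lambda>y. norm (\<alpha> y - \<alpha> m) * (2 * norm (P m) * K)) \<longlongrightarrow> 0) (at m)"
    using lim by (intro tendsto_mult_left_zero tendsto_norm_zero)
  ultimately have cont: "((\<lambda>y. P y - P m) \<longlongrightarrow> 0) (at m)"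
    by (rule Lim_null_comparison)
  \<comment> \<open>The remainder splits in two: \<open>r1\<close> treats the linearisation error of
    \<alpha>, \<open>r2\<close> the exchange of \<open>P y\<close> for \<open>P m\<close> in the
    linear term.\<close>
  have r1: "((\<lambda>y. (1 / norm (y - m)) *\<^sub>R B (\<alpha> y - \<alpha> m - \<alpha>' (y - m)) (P y)) \<longlongrightarrow> 0) (at m)"
  proof -
    have "((\<lambda>y. (1 / norm (y - m)) *\<^sub>R (\<alpha> y - (\<alpha> m + \<alpha>' (y - m)))) \<longlongrightarrow> 0) (at m)"
      using \<alpha> by (simp add: has_derivative_within)
    moreover have "(P \<longlongrightarrow> P m) (at m)" using cont by (simp add: LIM_zero_iff)
    ultimately have "((\<lambda>y. B ((1 / norm (y - m)) *\<^sub>R (\<alpha> y - (\<alpha> m + \<alpha>' (y - m)))) (P y)) \<longlongrightarrow> B 0 (P m)) (at m)"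
      by (rule B.tendsto)
    then show ?thesis by (simp add: B.scaleR_left B.zero_left diff_diff_eq)
  qed
  have r2: "((\<lambda>y. (1 / norm (y - m)) *\<^sub>R B (\<alpha>' (y - m)) (P y - P m)) \<longlongrightarrow> 0) (at m)"
  proof (rule Lim_null_comparison)
    show "\<forall>\<^sub>F y in at m. norm ((1 / norm (y - m)) *\<^sub>R B (\<alpha>' (y - m)) (P y - P m)) \<le>
        norm (P y - P m) * (K' * K)"
    proof (rule always_eventually, rule allI)
      fix y
      have "norm (B (\<alpha>' (y - m)) (P y - P m)) \<le> norm (\<alpha>' (y - m)) * norm (P y - P m) * K"
        by (rule K(2))
      also have "\<dots> \<le> (norm (y - m) * K') * norm (P y - P m) * K"
        using K(1) K'(2) by (intro mult_right_mono) auto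
      finally show "norm ((1 / norm (y - m)) *\<^sub>R B (\<alpha>' (y - m)) (P y - P m)) \<le>
          norm (P y - P m) * (K' * K)"
        using K(1) K'(1) by (cases "y = m") (auto simp: field_simps)
    qed
    show "((\<lambda>y. norm (P y - P m) * (K' * K)) \<longlongrightarrow> 0) (at m)"
      using cont by (intro tendsto_mult_left_zero tendsto_norm_zero)
  qed
  have "\<forall>\<^sub>F y in at m. - ((1 / norm (y - m)) *\<^sub>R B (\<alpha> y - \<alpha> m - \<alpha>' (y - m)) (P y)
        + (1 / norm (y - m)) *\<^sub>R B (\<alpha>' (y - m)) (P y - P m)) =
      (1 / norm (y - m)) *\<^sub>R (P y - (P m + - B (\<alpha>' (y - m)) (P m)))"
    using ev
  proof eventually_elim
    case (elim y)
    have "P y - (P m + - B (\<alpha>' (y - m)) (P m)) =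
        - (B (\<alpha> y - \<alpha> m - \<alpha>' (y - m)) (P y) + B (\<alpha>' (y - m)) (P y - P m))"
      by (subst elim) (simp add: B.diff_left B.diff_right)
    then show ?case by (simp only: scaleR_add_right scaleR_minus_right)
  qed
  moreover have "((\<lambda>y. - ((1 / norm (y - m)) *\<^sub>R B (\<alpha> y - \<alpha> m - \<alpha>' (y - m)) (P y)
        + (1 / norm (y - m)) *\<^sub>R B (\<alpha>' (y - m)) (P y - P m))) \<longlongrightarrow> 0) (at m)"
    using tendsto_minus[OF tendsto_add[OF r1 r2]] by simp
  ultimately have "((\<lambda>y. (1 / norm (y - m)) *\<^sub>R (P y - (P m + - B (\<alpha>' (y - m)) (P m)))) \<longlongrightarrow> 0) (at m)"
    by (rule Lim_transform_eventually[rotated])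
  moreover have "bounded_linear (\<lambda>h. - B (\<alpha>' h) (P m))"
    by (intro bounded_linear_minus bounded_linear_compose[OF B.bounded_linear_left] \<open>bounded_linear \<alpha>'\<close>)
  ultimately show ?thesis by (simp add: has_derivative_within)
qed

section \<open>The network system\<close>

lemma open_positive_orthant: "open {m :: real^'n. \<forall>i. 0 < m $ i}"
proof -
  have "{m :: real^'n. \<forall>i. 0 < m $ i} = (\<Inter>i. {m. 0 < m $ i})" by auto
  moreover have "open {m :: real^'n. 0 < m $ i}" for i
    by (intro open_Collect_less continuous_intros)
  ultimately show ?thesis by (simp add: open_INT)
qed

lemma unit_outer_mult_nth:
  "((columnvector (axis i 1) :: real^1^'n) ** (rowvector (axis i 1) :: real^'n^1) ** X) $ k $ l =
    (if k = i then X $ i $ l else 0)"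
  by (simp add: matrix_matrix_mult_def columnvector_def rowvector_def axis_def
    if_distrib[of "\<lambda>a. a * _"] if_distribR cong: if_cong)

lemma unit_outer_nth:
  "((columnvector (axis i 1) :: real^1^'n) ** (rowvector (axis i 1) :: real^'n^1)) $ k $ l =
    (if k = i \<and> l = i then 1 else 0)"
  by (simp add: matrix_matrix_mult_def columnvector_def rowvector_def axis_def)

lemma has_derivative_reciprocal_nth:
  fixes K :: "'b::real_normed_vector"
  assumes "m $ i \<noteq> 0"
  shows "((\<lambda>m. (1 / m $ i) *\<^sub>R K) has_derivative (\<lambda>h. (- h $ i / (m $ i)\<^sup>2) *\<^sub>R K)) (at m)"
  using assms
  by (auto intro!: derivative_eq_intros bounded_linear.has_derivative[OF bounded_linear_vec_nth]
    simp: power2_eq_square field_simps)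

text \<open>\<open>sysA\<close> and \<open>sysB\<close> are both affine in the reciprocal inertias.
  The formula for \<open>F\<close> is given only on the positive orthant, whose openness suffices
  for differentiation.\<close>

lemma has_derivative_reciprocal_sum:
  fixes K :: "'n::finite \<Rightarrow> 'b::real_normed_vector"
  assumes m: "\<forall>i. 0 < m $ i"
    and F: "\<And>m. \<forall>i. 0 < m $ i \<Longrightarrow> F m = K0 + (\<Sum>i\<in>UNIV. (1 / m $ i) *\<^sub>R K i)"
  shows "(F has_derivative (\<lambda>h. \<Sum>i\<in>UNIV. (- h $ i / (m $ i)\<^sup>2) *\<^sub>R K i)) (at m)"
proof (rule has_derivative_transform_within_open[OF _ open_positive_orthant])
  have "m $ i \<noteq> 0" for i using m by (metis less_irrefl)
  then show "((\<lambda>m. K0 + (\<Sum>i\<in>UNIV. (1 / m $ i) *\<^sub>R K i)) has_derivative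
      (\<lambda>h. \<Sum>i\<in>UNIV. (- h $ i / (m $ i)\<^sup>2) *\<^sub>R K i)) (at m)"
    by (intro has_derivative_eq_rhs[OF has_derivative_add[OF has_derivative_const
      has_derivative_sum[OF has_derivative_reciprocal_nth]]]) auto
qed (use m F in auto)

text \<open>Row \<open>i\<close> of the lower blocks carries \<open>- 1 / m $ i\<close>;
  differentiating the reciprocal flips the sign and gives the algorithm's \<open>A1\<close>.\<close>

lemma sysA_has_derivative:
  fixes L :: "real^'n^'n"
  assumes m: "\<forall>i. 0 < m $ i"
  obtains A' where "(sysA L d has_derivative A') (at m)"
    and "\<And>i. A' (axis i 1) = (let Minv = matrix_inv (diag m);
         \<Phi> = (columnvector (axis i 1) :: real^1^'n) ** (rowvector (axis i 1) :: real^'n^1)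
       in block22 0 0 (\<Phi> ** (Minv ** Minv) ** L) (\<Phi> ** (Minv ** Minv) ** diag d))"
proof -
  let ?\<Phi> = "\<lambda>i. (columnvector (axis i 1) :: real^1^'n) ** (rowvector (axis i 1) :: real^'n^1)"
  let ?K = "\<lambda>i. block22 0 0 (- (?\<Phi> i ** L)) (- (?\<Phi> i ** diag d))"
  let ?A' = "\<lambda>h. \<Sum>i\<in>UNIV. (- h $ i / (m $ i)\<^sup>2) *\<^sub>R ?K i"
  show ?thesis
  proof (rule that)
    have "sysA L d m $ k $ l = (block22 0 (mat 1) 0 0 + (\<Sum>i\<in>UNIV. (1 / m $ i) *\<^sub>R ?K i)) $ k $ l"
      if "\<forall>i. 0 < m $ i" for k l and m :: "real^'n"
      by (cases k; cases l) (auto simp: sysA_nth[OF that] block22_def unit_outer_mult_nth mat_def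
        diag_def if_distrib[of "\<lambda>a. _ * a"] if_distrib[of "\<lambda>a. - a"] cong: if_cong)
    then show "(sysA L d has_derivative ?A') (at m)"
      by (intro has_derivative_reciprocal_sum[OF m, where ?K0.0 = "block22 0 (mat 1) 0 0"])
        (simp add: vec_eq_iff)
  next
    fix i
    have "?A' (axis i 1) = (\<Sum>j\<in>UNIV. if j = i then (- 1 / (m $ i)\<^sup>2) *\<^sub>R ?K i else 0)"
      by (rule sum.cong) (auto simp: axis_def)
    then have A': "?A' (axis i 1) = (- 1 / (m $ i)\<^sup>2) *\<^sub>R ?K i" by simp
    have m0: "\<forall>i. m $ i \<noteq> 0" using m by (metis less_irrefl)
    show "?A' (axis i 1) = (let Minv = matrix_inv (diag m); \<Phi> = ?\<Phi> i
       in block22 0 0 (\<Phi> ** (Minv ** Minv) ** L) (\<Phi> ** (Minv ** Minv) ** diag d))"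
      unfolding A' Let_def matrix_inv_diag[OF m0] vec_eq_iff
    proof (intro allI)
      fix k l
      let ?Mi = "diag (\<chi> i. 1 / m $ i)"
      show "((- 1 / (m $ i)\<^sup>2) *\<^sub>R ?K i) $ k $ l =
        block22 0 0 (?\<Phi> i ** (?Mi ** ?Mi) ** L) (?\<Phi> i ** (?Mi ** ?Mi) ** diag d) $ k $ l"
        unfolding matrix_mul_assoc[symmetric, of "?\<Phi> i"]
        by (cases k; cases l) (auto simp: block22_def unit_outer_mult_nth unit_outer_nth diag_nth
          matrix_mul_assoc[symmetric, of ?Mi] power2_eq_square)
    qed
  qed
qed

text \<open>Row \<open>i\<close> of the lower block carries \<open>1 / m $ i\<close>, so the
  derivative keeps the minus sign of the algorithm's \<open>B1\<close>.\<close>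

lemma sysB_has_derivative:
  fixes v :: "real^'n"
  assumes m: "\<forall>i. 0 < m $ i"
  obtains B' where "(sysB v has_derivative B') (at m)"
    and "\<And>i. B' (axis i 1) = (let Minv = matrix_inv (diag m);
         \<Phi> = (columnvector (axis i 1) :: real^1^'n) ** (rowvector (axis i 1) :: real^'n^1)
       in block21 0 (- (\<Phi> ** (Minv ** Minv) ** psd_sqrt (diag v))))"
proof -
  let ?\<Phi> = "\<lambda>i. (columnvector (axis i 1) :: real^1^'n) ** (rowvector (axis i 1) :: real^'n^1)"
  let ?R = "psd_sqrt (diag v)"
  let ?K = "\<lambda>i. block21 0 (?\<Phi> i ** ?R)"
  let ?B' = "\<lambda>h. \<Sum>i\<in>UNIV. (- h $ i / (m $ i)\<^sup>2) *\<^sub>R ?K i"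
  show ?thesis
  proof (rule that)
    have "sysB v m $ k $ l = (0 + (\<Sum>i\<in>UNIV. (1 / m $ i) *\<^sub>R ?K i)) $ k $ l"
      if "\<forall>i. 0 < m $ i" for k l and m :: "real^'n"
    proof -
      have m0: "\<forall>i. m $ i \<noteq> 0" using that by (metis less_irrefl)
      show ?thesis
        by (cases k) (auto simp: sysB_def matrix_inv_diag[OF m0] block21_def unit_outer_mult_nth
          if_distrib[of "\<lambda>a. _ * a"] cong: if_cong)
    qed
    then show "(sysB v has_derivative ?B') (at m)"
      by (intro has_derivative_reciprocal_sum[OF m, where ?K0.0 = 0]) (simp add: vec_eq_iff)
  next
    fix i
    have "?B' (axis i 1) = (\<Sum>j\<in>UNIV. if j = i then (- 1 / (m $ i)\<^sup>2) *\<^sub>R ?K i else 0)"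
      by (rule sum.cong) (auto simp: axis_def)
    then have B': "?B' (axis i 1) = (- 1 / (m $ i)\<^sup>2) *\<^sub>R ?K i" by simp
    have m0: "\<forall>i. m $ i \<noteq> 0" using m by (metis less_irrefl)
    show "?B' (axis i 1) = (let Minv = matrix_inv (diag m); \<Phi> = ?\<Phi> i
       in block21 0 (- (\<Phi> ** (Minv ** Minv) ** ?R)))"
      unfolding B' Let_def matrix_inv_diag[OF m0] vec_eq_iff
    proof (intro allI)
      fix k l
      let ?Mi = "diag (\<chi> i. 1 / m $ i)"
      show "((- 1 / (m $ i)\<^sup>2) *\<^sub>R ?K i) $ k $ l =
        block21 0 (- (?\<Phi> i ** (?Mi ** ?Mi) ** ?R)) $ k $ l"
        unfolding matrix_mul_assoc[symmetric, of "?\<Phi> i"]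
        by (cases k) (auto simp: block21_def unit_outer_mult_nth
          matrix_mul_assoc[symmetric, of ?Mi] power2_eq_square)
    qed
  qed
qed

lemma vector_matrix_mult_add: "x v* (A + B) = x v* A + x v* (B :: real^'b^'a)"
  by (simp add: vec_eq_iff vector_matrix_mult_def algebra_simps sum.distrib)

text \<open>This places the right-hand side built from \<open>sysC\<close> among the matrices
  annihilating \<open>z0\<close>, where the Lyapunov equation is solvable.\<close>

lemma sysC_null:
  assumes "psd N" and "N *v (\<chi> i. 1) = 0"
  shows "sysC N s *v z0 = 0"
proof -
  have "(sysC N s *v z0) $ k = 0" for k
  proof (cases k)
    case (Inl i)
    then have "(sysC N s *v z0) $ k = (psd_sqrt N *v (\<chi> i. 1)) $ i"
      by (simp add: matrix_vector_mult_def sum_UNIV_Plus sysC_def block22_def z0_def)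
    then show ?thesis using psd_sqrt_null[OF assms] by simp
  next
    case (Inr i)
    then show ?thesis
      by (simp add: matrix_vector_mult_def sum_UNIV_Plus sysC_def block22_def z0_def)
  qed
  then show ?thesis by (simp add: vec_eq_iff)
qed

section \<open>Existence and symmetry of Lyapunov solutions; the gradient\<close>

context connected_network
begin

lemma sysA_z0:
  assumes m: "\<forall>i. 0 < m $ i"
  shows "sysA L d m *v z0 = 0"
proof -
  have "(sysA L d m *v z0) $ k = 0" for k
  proof (cases k)
    case (Inr i)
    then have "(sysA L d m *v z0) $ k = - (L *v (\<chi> i. 1)) $ i / m $ i"
      by (simp add: matrix_vector_mult_def sum_UNIV_Plus sysA_nth[OF m] z0_def sum_negf sum_divide_distrib)
    then show ?thesis by (simp add: L_const)
  qed (simp add: matrix_vector_mult_def sum_UNIV_Plus sysA_nth[OF m] z0_def)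
  then show ?thesis by (simp add: vec_eq_iff)
qed

lemma lyapunov_op_inj:
  assumes m: "\<forall>i. 0 < m $ i"
  shows "inj_on (\<lambda>P. P ** sysA L d m + transpose (sysA L d m) ** P) {P. P *v z0 = 0}"
proof (rule inj_onI)
  fix P P'
  assume P: "P \<in> {P. P *v z0 = 0}" "P' \<in> {P. P *v z0 = 0}"
    "P ** sysA L d m + transpose (sysA L d m) ** P = P' ** sysA L d m + transpose (sysA L d m) ** P'"
  interpret bounded_bilinear "\<lambda>A P. P ** A + transpose A ** (P :: real^('n + 'n)^('n + 'n))"
    by (rule bounded_bilinear_lyapunov)
  have "P - P' = 0"
  proof (rule lyapunov_unique[OF m])
    show "(P - P') *v z0 = 0" using P by (simp add: matrix_vector_mult_diff_rdistrib)
    show "(P - P') ** sysA L d m + transpose (sysA L d m) ** (P - P') = 0"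
      using P(3) by (simp add: diff_right)
  qed
  then show "P = P'" by simp
qed

lemma subspace_z0_null: "subspace {P :: real^('n + 'n)^('n + 'n). P *v z0 = 0}"
  by (auto simp: subspace_def matrix_vector_mult_add_rdistrib scaleR_matrix_vector_assoc[symmetric])

text \<open>On the matrices annihilating \<open>z0\<close>, injectivity gives surjectivity by
  dimension; both together justify the definite description in \<open>lyap\<close>.\<close>

lemma lyap_solution:
  assumes m: "\<forall>i. 0 < m $ i" and Q: "Q *v z0 = 0"
  shows "lyap (sysA L d m) Q ** sysA L d m + transpose (sysA L d m) ** lyap (sysA L d m) Q + Q = 0"
    and "lyap (sysA L d m) Q *v z0 = 0"
proof -
  let ?A = "sysA L d m"
  let ?T = "\<lambda>P. P ** ?A + transpose ?A ** P"
  let ?W = "{P :: real^('n + 'n)^('n + 'n). P *v z0 = 0}"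
  have T: "linear ?T" by (rule linear_lyapunov)
  have span: "span ?W = ?W" using subspace_z0_null by (simp add: span_eq_iff)
  have sub: "?T ` ?W \<subseteq> ?W"
    by (auto simp: matrix_vector_mult_add_rdistrib matrix_vector_mul_assoc[symmetric] sysA_z0[OF m])
  have "dim (?T ` ?W) = dim ?W"
    using lyapunov_op_inj[OF m] by (intro dim_image_eq T) (simp add: span)
  then have surj: "?T ` ?W = ?W"
    using subspace_dim_equal[OF linear_subspace_image[OF T subspace_z0_null] subspace_z0_null sub]
    by simp
  have "- Q \<in> ?W" using Q
    by (metis (mono_tags, lifting) mem_Collect_eq subspace_neg subspace_z0_null)
  then have "- Q \<in> ?T ` ?W" by (simp only: surj)
  then obtain P where P: "- Q = ?T P" "P \<in> ?W" by (rule imageE)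
  have "\<exists>!P. P ** ?A + transpose ?A ** P + Q = 0 \<and> P *v z0 = 0"
  proof (rule ex1I[of _ P])
    show "P ** ?A + transpose ?A ** P + Q = 0 \<and> P *v z0 = 0"
      using P by (simp flip: P(1))
    fix P' assume "P' ** ?A + transpose ?A ** P' + Q = 0 \<and> P' *v z0 = 0"
    then have P': "P' \<in> ?W" "?T P' = - Q" by (simp_all add: eq_neg_iff_add_eq_0 del: minus_add_distrib)
    show "P' = P"
      by (rule inj_onD[OF lyapunov_op_inj[OF m]]) (use P P' in simp_all)
  qed
  from theI'[OF this, folded lyap_def]
  show "lyap ?A Q ** ?A + transpose ?A ** lyap ?A Q + Q = 0" and "lyap ?A Q *v z0 = 0"
    by (rule conjunct1, rule conjunct2)
qed

text \<open>The transpose solves the same equation; the point is that it also annihilates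
  \<open>z0\<close>. Multiplying the equation by \<open>z0\<close> from the left shows that
  \<open>z0 v* P\<close> is a left null vector, and it is orthogonal to \<open>z0\<close>, hence
  zero.\<close>

lemma lyap_symmetric:
  assumes m: "\<forall>i. 0 < m $ i" and Q: "Q *v z0 = 0" and sym: "transpose Q = Q"
  shows "transpose (lyap (sysA L d m) Q) = lyap (sysA L d m) Q"
proof -
  let ?A = "sysA L d m"
  define P where "P = lyap ?A Q"
  have P: "P ** ?A + transpose ?A ** P + Q = 0" "P *v z0 = 0"
    unfolding P_def by (rule lyap_solution[OF m Q])+
  have tadd: "transpose (X + Y) = transpose X + transpose Y" for X Y :: "real^('n+'n)^('n+'n)"
    by (simp add: transpose_def vec_eq_iff)
  have "transpose (P ** ?A + transpose ?A ** P + Q) = 0"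
    by (simp only: P) (simp add: transpose_def vec_eq_iff)
  then have PT: "transpose P ** ?A + transpose ?A ** transpose P + Q = 0"
    by (simp add: tadd matrix_transpose_mul sym add.commute)
  have "z0 v* P = 0"
  proof (rule sysA_left_null_eq_0[OF m])
    have "z0 v* transpose ?A = 0" using sysA_z0[OF m] by simp
    moreover have "z0 v* Q = 0" using Q sym by (metis vector_transpose_matrix)
    moreover have "z0 v* (P ** ?A + transpose ?A ** P + Q) = 0" by (simp add: P)
    ultimately show "(z0 v* P) v* ?A = 0"
      by (simp add: vector_matrix_mul_assoc[symmetric] vector_matrix_mult_add)
    show "(z0 v* P) \<bullet> z0 = 0" by (simp add: dot_lmul_matrix P)
  qed
  then have PTz: "transpose P *v z0 = 0" by simp
  have eq: "transpose P ** ?A + transpose ?A ** transpose P = P ** ?A + transpose ?A ** P"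
    using P(1) PT by (metis add_right_imp_eq)
  show ?thesis
    unfolding P_def[symmetric]
    by (rule inj_onD[OF lyapunov_op_inj[OF m] eq])
      (use P(2) PTz in \<open>simp_all del: transpose_matrix_vector\<close>)
qed

text \<open>Product rule for the trace; the derivative of the Gramian in direction
  \<open>axis i 1\<close> is the algorithm's \<open>P1\<close>.\<close>

lemma h2sq_gderiv:
  assumes N: "psd N" "N *v (\<chi> i. 1) = 0" and m: "\<forall>i. 0 < m $ i"
  shows "GDERIV (h2sq L N d v s) m :> grad_alg L N d v s m"
proof -
  let ?A = "sysA L d m" and ?B = "sysB v m"
  define Q where "Q = transpose (sysC N s) ** sysC N s"
  define P where "P = obsv_gram L N d s"
  let ?W = "{P :: real^('n + 'n)^('n + 'n). P *v z0 = 0}"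
  have Qz: "Q *v z0 = 0"
    by (simp add: Q_def matrix_vector_mul_assoc[symmetric] sysC_null[OF N] del: transpose_matrix_vector)
  have Qsym: "transpose Q = Q" by (simp add: Q_def matrix_transpose_mul)
  have P_eq: "P y = lyap (sysA L d y) Q" for y by (simp add: P_def obsv_gram_def Q_def)
  have P: "P y ** sysA L d y + transpose (sysA L d y) ** P y + Q = 0" "P y *v z0 = 0"
    if "\<forall>i. 0 < y $ i" for y
    unfolding P_eq by (rule lyap_solution[OF that Qz])+
  have Psym: "transpose (P m) = P m" unfolding P_eq by (rule lyap_symmetric[OF m Qz Qsym])
  let ?T = "\<lambda>A X. X ** A + transpose A ** (X :: real^('n + 'n)^('n + 'n))"
  interpret T: bounded_bilinear ?T
    by (rule bounded_bilinear_lyapunov)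
  have span: "span ?W = ?W" using subspace_z0_null by (simp add: span_eq_iff)
  have "inj_on (?T ?A) (span ?W)" unfolding span by (rule lyapunov_op_inj[OF m])
  \<comment> \<open>\<open>S\<close> inverts the operator on \<open>?W\<close> but is linear on the
    whole matrix space, as the perturbation lemma requires.\<close>
  from linear_inj_on_left_inverse[OF linear_lyapunov this]
  obtain S where S: "linear S" "\<And>X. X *v z0 = 0 \<Longrightarrow> S (?T ?A X) = X"
    unfolding span by auto
  interpret S: linear S by (rule S)
  obtain A' where A': "(sysA L d has_derivative A') (at m)"
    "\<And>i. A' (axis i 1) = (let Minv = matrix_inv (diag m);
         \<Phi> = (columnvector (axis i 1) :: real^1^'n) ** (rowvector (axis i 1) :: real^'n^1)
       in block22 0 0 (\<Phi> ** (Minv ** Minv) ** L) (\<Phi> ** (Minv ** Minv) ** diag d))"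
    by (rule sysA_has_derivative[OF m]) (rule that, assumption+)
  obtain B' where B': "(sysB v has_derivative B') (at m)"
    "\<And>i. B' (axis i 1) = (let Minv = matrix_inv (diag m);
         \<Phi> = (columnvector (axis i 1) :: real^1^'n) ** (rowvector (axis i 1) :: real^'n^1)
       in block21 0 (- (\<Phi> ** (Minv ** Minv) ** psd_sqrt (diag v))))"
    by (rule sysB_has_derivative[OF m]) (rule that, assumption+)
  let ?P' = "\<lambda>h. - S (?T (A' h) (P m))"
  have "(P has_derivative ?P') (at m)"
  proof (rule has_derivative_fixed_point_perturbation[OF _ A'(1)])
    have "bilinear (\<lambda>A X. S (?T A X))"
      using linear_compose[OF bounded_linear.linear[OF T.bounded_linear_left] S(1)]
        linear_compose[OF bounded_linear.linear[OF T.bounded_linear_right] S(1)]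
      by (simp add: bilinear_def o_def)
    then show "bounded_bilinear (\<lambda>A X. S (?T A X))" by (simp add: bilinear_conv_bounded_bilinear)
    have "\<forall>\<^sub>F y in at m. \<forall>i. 0 < y $ i"
      using eventually_nhds_in_open[OF open_positive_orthant, of m] m
      by (auto simp: eventually_at_filter elim: eventually_mono)
    \<comment> \<open>Subtract the Lyapunov equations at \<open>y\<close> and \<open>m\<close>,
      which share \<open>Q\<close>, and apply \<open>S\<close> to the resulting expression for
      \<open>?T ?A (P m - P y)\<close>.\<close>
    then show "\<forall>\<^sub>F y in at m. P y = P m - S (?T (sysA L d y - ?A) (P y))"
    proof eventually_elim
      case (elim y)
      have "?T (sysA L d y - ?A) (P y) = ?T (sysA L d y) (P y) - ?T ?A (P y)" by (rule T.diff_left)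
      also have "?T (sysA L d y) (P y) = ?T ?A (P m)"
        using P(1)[OF elim] P(1)[OF m] by (metis add_right_imp_eq)
      also have "?T ?A (P m) - ?T ?A (P y) = ?T ?A (P m - P y)" by (rule T.diff_right[symmetric])
      finally show ?case
        using S(2)[of "P m - P y"] P(2)[OF elim] P(2)[OF m]
        by (simp add: matrix_vector_mult_diff_rdistrib)
    qed
  qed
  then have D: "((\<lambda>y. trace (transpose (sysB v y) ** P y ** sysB v y)) has_derivative
      (\<lambda>h. trace (transpose ?B ** P m ** B' h +
        (transpose ?B ** ?P' h + transpose (B' h) ** P m) ** ?B))) (at m)" (is "(?f has_derivative ?D) _")
    by (intro bounded_linear.has_derivative[OF bounded_linear_trace]
      bounded_bilinear.FDERIV[OF bounded_bilinear_matrix_mult]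
      bounded_linear.has_derivative[OF bounded_linear_transpose] B'(1))
  have f: "?f = h2sq L N d v s" by (simp add: fun_eq_iff h2sq_def P_def)
  have "?D (axis i 1) = grad_alg L N d v s m $ i" for i
  proof -
    let ?A1 = "A' (axis i 1)" and ?B1 = "B' (axis i 1)"
    let ?Q1 = "P m ** ?A1 + transpose ?A1 ** P m"
    have g: "grad_alg L N d v s m $ i = trace (2 *\<^sub>R (transpose ?B1 ** P m ** ?B)
        + transpose ?B ** lyap ?A ?Q1 ** ?B)"
      by (simp add: grad_alg_def Let_def A'(2) B'(2) P_def)
    \<comment> \<open>Needed for \<open>?Q1\<close> to annihilate \<open>z0\<close>, so that
      \<open>lyap\<close> returns a genuine solution; it holds because \<open>L\<close> annihilates
      constants.\<close>
    have "(?A1 *v z0) $ k = 0" for k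
    proof (cases k)
      case (Inr j)
      have "(?A1 *v z0) $ k = (((columnvector (axis i 1) :: real^1^'n) ** (rowvector (axis i 1) :: real^'n^1)
        ** (matrix_inv (diag m) ** matrix_inv (diag m)) ** L) *v (\<chi> i. 1)) $ j"
        using Inr by (simp add: A'(2) Let_def block22_def matrix_vector_mult_def sum_UNIV_Plus z0_def)
      then show ?thesis by (simp only: matrix_vector_mul_assoc[symmetric] L_const) simp
    qed (simp add: A'(2) Let_def block22_def matrix_vector_mult_def sum_UNIV_Plus z0_def)
    then have "?A1 *v z0 = 0" by (simp add: vec_eq_iff)
    then have "?Q1 *v z0 = 0"
      by (simp add: matrix_vector_mult_add_rdistrib matrix_vector_mul_assoc[symmetric] P(2)[OF m])
    note P1 = lyap_solution[OF m this]
    have "?P' (axis i 1) = lyap ?A ?Q1"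
    proof -
      have "?T ?A (lyap ?A ?Q1) = - ?Q1"
        using P1(1) by (simp only: eq_neg_iff_add_eq_0)
      then have "lyap ?A ?Q1 = S (- ?Q1)" using S(2)[OF P1(2)] by (simp only:)
      then show ?thesis by (simp only: S.neg)
    qed
    moreover have "trace (transpose ?B ** P m ** ?B1) = trace (transpose ?B1 ** P m ** ?B)"
      using trace_transpose[of "transpose ?B ** P m ** ?B1"]
      by (simp add: matrix_transpose_mul Psym matrix_mul_assoc)
    moreover have "trace (2 *\<^sub>R X) = 2 * trace X" for X :: "real^'n^'n"
      by (simp add: trace_def sum_distrib_left)
    ultimately show ?thesis
      unfolding g by (simp only: trace_add matrix_add_rdistrib)
  qed
  then have "?D h = h \<bullet> grad_alg L N d v s m" for h
  proof -
    interpret D: linear ?D using D by (rule has_derivative_linear)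
    have "?D h = ?D (\<Sum>i\<in>UNIV. h $ i *\<^sub>R axis i 1)"
      by (metis (no_types, lifting) basis_expansion scalar_mult_eq_scaleR sum.cong)
    also have "\<dots> = (\<Sum>i\<in>UNIV. h $ i * grad_alg L N d v s m $ i)"
      by (simp only: D.sum D.scale \<open>\<And>i. ?D (axis i 1) = _ i\<close> real_scaleR_def)
    finally show ?thesis by (simp add: inner_vec_def)
  qed
  then show ?thesis using D unfolding gderiv_def f by simp
qed

end

theorem theorem6:
  fixes b a :: "'n::finite \<Rightarrow> 'n \<Rightarrow> real"
    and d v s :: "real^'n"
  assumes "weighted_graph b" and "connected_graph b"
    and "weighted_graph a" and "connected_graph a"
    and "\<forall>i. 0 < d $ i"
    and "\<forall>i. 0 \<le> v $ i"
    and "\<forall>i. 0 < s $ i"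
  shows "h2sq (laplacian b) (laplacian a) d v s differentiable_on {m. \<forall>i. 0 < m $ i} \<and>
    (\<forall>m. (\<forall>i. 0 < m $ i) \<longrightarrow>
      (GDERIV (h2sq (laplacian b) (laplacian a) d v s) m :>
        grad_alg (laplacian b) (laplacian a) d v s m))"
proof -
  interpret connected_network "laplacian b" d
    using assms psd_laplacian laplacian_null_const by unfold_locales auto
  have G: "GDERIV (h2sq (laplacian b) (laplacian a) d v s) m :>
      grad_alg (laplacian b) (laplacian a) d v s m" if "\<forall>i. 0 < m $ i" for m
    using psd_laplacian[OF assms(3)] laplacian_mult_const that by (rule h2sq_gderiv)
  then have "h2sq (laplacian b) (laplacian a) d v s differentiable_on {m. \<forall>i. 0 < m $ i}"
    unfolding differentiable_on_def gderiv_def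
    by (auto intro: differentiable_at_withinI differentiableI)
  with G show ?thesis by blast
qed

end
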